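(* Let $k$ be a positive integer. Then the square matrix $B_k^{k-2}$ is persymmetric, and it is similar to its transpose $(B_k^{k-2})^t$ by a permutation of rows and columns, i.e. there is a permutation matrix $P$ with $P^{-1}B_k^{k-2}P=(B_k^{k-2})^t$.
   Context: $C^a_b$ denotes the binomial coefficient "$a$ choose $b$". For an $m\times n$ matrix $A=(a_{ij})$, the flip-transpose ${}^tA$ is the reflection of $A$ across its skew-diagonal, i.e. the $n\times m$ matrix whose $(i,j)$ entry is $a_{m-j+1,\,n-i+1}$; $A$ is persymmetric if ${}^tA=A$. The ordinary transpose is written $A^t$. $I_p$ is the $p\times p$ identity matrix and $J_p$ is the $p\times p$ all-ones matrix minus $I_p$. If $X$ has $m$ columns and $Y$ is $m\times m$, then $X(Y)$ denotes the matrix obtained by pasting $Y$ below $X$. For $X$ of order $n_1\times m_1$ and $Y$ of order $n_2\times m_2$ with $n_1\ge n_2$, $X\sqcup Y$ is the $n_1\times(m_1+m_2)$ matrix obtained by placing $Y$ to the right of $X$ with the bottom rows aligned and filling the remaining upper right $(n_1-n_2)\times m_2$ block with ones; longer expressions are formed from left to right. The matrices $B_k^{j}$ ($k\ge1$, $j\ge-1$): $B_k^{-1}=(0,\ldots,0)$ of order $1\times k$ and, for $j\ge0$, $B_k^{j}=B_k^{j-1}(J_{C^{k+j}_{j+1}})\sqcup B_{k-1}^{j-1}(J_{C^{k-1+j}_{j+1}})\sqcup\cdots\sqcup B_1^{j-1}(J_{C^{1+j}_{j+1}})$, where the pasted square matrices have as many rows as the matrix above them has columns. The matrix $B_k^{k-2}$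 has order $C^{2k-1}_{k-1}\times C^{2k-1}_k$, hence is square. *)

theory Defs
  imports "Jordan_Normal_Form.Matrix"
begin

text \<open>Matrix entries are indexed from \<open>0\<close> (the library convention), so that \<open>m - j + 1\<close>
  becomes \<open>m - 1 - j\<close>.\<close>

definition flip_transpose :: "'a mat \<Rightarrow> 'a mat" where
  "flip_transpose A = mat (dim_col A) (dim_row A)
     (\<lambda>(i, j). A $$ (dim_row A - 1 - j, dim_col A - 1 - i))"

definition persymmetric :: "'a mat \<Rightarrow> bool" where
  "persymmetric A \<longleftrightarrow> flip_transpose A = A"

definition ones_mat :: "nat \<Rightarrow> nat \<Rightarrow> int mat" where
  "ones_mat m n = mat m n (\<lambda>_. 1)"

definition J_mat :: "nat \<Rightarrow> int mat" where
  "J_mat p = ones_mat p p - 1\<^sub>m p"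

text \<open>The matrix obtained from \<open>X\<close> by putting \<open>Y\<close> to its right, bottom rows aligned, with the
  upper right block filled with ones. Meaningful if \<open>Y\<close> has at most as many rows as \<open>X\<close>.\<close>

definition bottom_join :: "int mat \<Rightarrow> int mat \<Rightarrow> int mat" (infixl \<open>\<squnion>\<^sub>m\<close> 65) where
  "X \<squnion>\<^sub>m Y = mat (dim_row X) (dim_col X + dim_col Y)
     (\<lambda>(i, j). if j < dim_col X then X $$ (i, j)
        else let d = dim_row X - dim_row Y in
          if i < d then 1 else Y $$ (i - d, j - dim_col X))"

text \<open>The superscript of \<open>B\<^sub>k\<^sup>j\<close> starts at \<open>-1\<close>: \<open>B_shift k n\<close> is \<open>B\<^sub>k\<^sup>j\<close> for \<open>j = n - 1\<close>. So in the
  recursive equation, which describes \<open>j = n\<close>, the block coming from \<open>i\<close> is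
  \<open>B\<^sub>i\<^sup>j\<^sup>-\<^sup>1\<close> with a \<open>J\<close> of size \<open>i + j\<close> choose \<open>j + 1\<close> below it, and \<open>i\<close> runs through
  \<open>k, k - 1, \<dots>, 1\<close>. The operator \<open>@\<^sub>r\<close> is the pasting \<open>X(Y)\<close>.\<close>

fun B_shift :: "nat \<Rightarrow> nat \<Rightarrow> int mat" where
  "B_shift k 0 = 0\<^sub>m 1 k"
| "B_shift k (Suc n) =
     (let block = (\<lambda>i. B_shift i n @\<^sub>r J_mat ((i + n) choose (n + 1)))
      in foldl (\<squnion>\<^sub>m) (block k) (map block (rev [1..<k])))"

text \<open>Only relevant for \<open>k \<ge> 1\<close> and \<open>j \<ge> -1\<close>.\<close>

definition B_mat :: "nat \<Rightarrow> int \<Rightarrow> int mat" where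
  "B_mat k j = B_shift k (nat (j + 1))"

definition permutation_mat :: "nat \<Rightarrow> int mat \<Rightarrow> bool" where
  "permutation_mat n P \<longleftrightarrow>
     (\<exists>\<sigma>. \<sigma> permutes {..<n} \<and> P = mat n n (\<lambda>(i, j). if i = \<sigma> j then 1 else 0))"

text \<open>The orders of the matrices; they confirm that every pasting and joining above is between
  matrices of compatible sizes.\<close>

lemma dim_bottom_join [simp]:
  "dim_row (X \<squnion>\<^sub>m Y) = dim_row X" "dim_col (X \<squnion>\<^sub>m Y) = dim_col X + dim_col Y"
  by (simp_all add: bottom_join_def)

lemma dim_foldl_bottom_join:
  "dim_row (foldl (\<squnion>\<^sub>m) X Ys) = dim_row X"
  "dim_col (foldl (\<squnion>\<^sub>m) X Ys) = dim_col X + (\<Sum>Y\<leftarrow>Ys. dim_col Y)"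
  by (induction Ys arbitrary: X) simp_all

lemma dim_J_mat [simp]: "dim_row (J_mat p) = p" "dim_col (J_mat p) = p"
  by (simp_all add: J_mat_def)

lemma sum_choose_blocks:
  "k \<ge> 1 \<Longrightarrow> ((k + n) choose Suc n) + (\<Sum>i\<leftarrow>rev [1..<k]. (i + n) choose Suc n)
     = (k + Suc n) choose Suc (Suc n)"
proof (induction k rule: nat_induct_at_least)
  case base
  then show ?case by simp
next
  case (Suc k)
  then show ?case by simp
qed

lemma B_shift_carrier:
  "k \<ge> 1 \<Longrightarrow> B_shift k n \<in> carrier_mat ((k + n) choose n) ((k + n) choose (n + 1))"
proof (induction n arbitrary: k)
  case 0
  then show ?case by simp
next
  case (Suc n)
  define block where "block = (\<lambda>i. B_shift i n @\<^sub>r J_mat ((i + n) choose (n + 1)))"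
  have r: "dim_row (block i) = (i + Suc n) choose Suc n"
    and c: "dim_col (block i) = (i + n) choose Suc n" if "i \<ge> 1" for i
    using Suc.IH[OF that] by (auto simp: block_def append_rows_def)
  have eq: "B_shift k (Suc n) = foldl (\<squnion>\<^sub>m) (block k) (map block (rev [1..<k]))"
    by (simp add: block_def)
  have "(\<Sum>Y\<leftarrow>map block (rev [1..<k]). dim_col Y) = (\<Sum>i\<leftarrow>rev [1..<k]. (i + n) choose Suc n)"
    by (auto intro!: arg_cong[where f = sum_list] simp: c)
  then show ?case
    unfolding eq using r[OF Suc.prems] c[OF Suc.prems] sum_choose_blocks[OF Suc.prems, of n]
    by (intro carrier_matI) (simp_all add: dim_foldl_bottom_join)
qed

lemma B_mat_square:
  assumes "k \<ge> 1"
  shows "B_mat k (int k - 2) \<in> carrier_mat ((2 * k - 1) choose (k - 1)) ((2 * k - 1) choose k)"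
    and "(2 * k - 1) choose k = (2 * k - 1) choose (k - 1)"
proof -
  have "nat (int k - 2 + 1) = k - 1" "k + (k - 1) = 2 * k - 1" "k - 1 + 1 = k"
    using assms by auto
  then show "B_mat k (int k - 2) \<in> carrier_mat ((2 * k - 1) choose (k - 1)) ((2 * k - 1) choose k)"
    using B_shift_carrier[OF assms, of "k - 1"] by (simp add: B_mat_def)
  have "2 * k - 1 - k = k - 1" by simp
  then show "(2 * k - 1) choose k = (2 * k - 1) choose (k - 1)"
    using binomial_symmetric[of k "2 * k - 1"] assms by simp
qed

end

theory Submission
  imports Defs
begin

text \<open>The matrix \<open>B_shift k n\<close> is the non-inclusion matrix of the \<open>n\<close>-subsets against the
  \<open>(n + 1)\<close>-subsets of a set with \<open>k + n\<close> elements, both listed lexicographically. Separating the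
  subsets that contain the smallest element gives a Pascal-type block recursion for
  \<open>B_shift (k + 1) (n + 1)\<close>, with blocks \<open>B_shift (k + 1) n\<close>, all ones, \<open>J\<close> and \<open>B_shift k (n + 1)\<close>. The flip-transpose exchanges the two
  diagonal blocks, so by induction it exchanges \<open>k\<close> and \<open>n + 1\<close> (combinatorially: it passes to
  complements), and the case \<open>n = k - 1\<close> is persymmetry. As the flip-transpose of a square matrix is
  its transpose conjugated by the reversal of the indices, the reversal is the required permutation.\<close>

lemma dim_flip_transpose [simp]:
  "dim_row (flip_transpose A) = dim_col A" "dim_col (flip_transpose A) = dim_row A"
  by (simp_all add: flip_transpose_def)

lemma index_flip_transpose [simp]:
  "i < dim_col A \<Longrightarrow> j < dim_row A \<Longrightarrow>
    flip_transpose A $$ (i, j) = A $$ (dim_row A - 1 - j, dim_col A - 1 - i)"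
  by (simp add: flip_transpose_def)

lemma flip_transpose_zero_mat: "flip_transpose (0\<^sub>m m n) = 0\<^sub>m n m"
  by (rule eq_matI) auto

lemma dim_ones_mat [simp]: "dim_row (ones_mat m n) = m" "dim_col (ones_mat m n) = n"
  by (simp_all add: ones_mat_def)

lemma ones_mat_carrier [simp]: "ones_mat m n \<in> carrier_mat m n"
  by (simp add: ones_mat_def)

lemma J_mat_carrier [simp]: "J_mat p \<in> carrier_mat p p"
  by (simp add: carrier_matI)

lemma flip_transpose_ones_mat: "flip_transpose (ones_mat m n) = ones_mat n m"
  by (rule eq_matI) (auto simp: ones_mat_def)

lemma flip_transpose_J_mat: "flip_transpose (J_mat p) = J_mat p"
  by (rule eq_matI) (auto simp: J_mat_def ones_mat_def)

text \<open>Reflection across the skew-diagonal swaps the upper left and lower right corners and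
  fixes the other two, so only the diagonal blocks trade places.\<close>

lemma flip_transpose_four_block_mat:
  assumes "A \<in> carrier_mat m1 n1" "B \<in> carrier_mat m1 n2"
    "C \<in> carrier_mat m2 n1" "D \<in> carrier_mat m2 n2"
  shows "flip_transpose (four_block_mat A B C D) =
    four_block_mat (flip_transpose D) (flip_transpose B) (flip_transpose C) (flip_transpose A)"
proof (rule eq_matI)
  fix i j
  assume "i < dim_row (four_block_mat (flip_transpose D) (flip_transpose B)
      (flip_transpose C) (flip_transpose A))"
    and "j < dim_col (four_block_mat (flip_transpose D) (flip_transpose B)
      (flip_transpose C) (flip_transpose A))"
  then have i: "i < n2 + n1" and j: "j < m2 + m1"
    using assms by auto
  consider "i < n2" "j < m2" | "i < n2" "\<not> j < m2" | "\<not> i < n2" "j < m2" | "\<not> i < n2" "\<not> j < m2"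
    by blast
  then show "flip_transpose (four_block_mat A B C D) $$ (i, j) =
    four_block_mat (flip_transpose D) (flip_transpose B) (flip_transpose C) (flip_transpose A) $$ (i, j)"
  proof cases
    case 1
    \<comment> \<open>Each case rewrites the reflected indices in the local coordinates of the block
      they fall into.\<close>
    have "m1 + m2 - 1 - j - m1 = m2 - 1 - j" "n1 + n2 - 1 - i - n1 = n2 - 1 - i"
      using 1 by auto
    then show ?thesis using assms i j 1 by auto
  next
    case 2
    have "m1 + m2 - 1 - j = m1 - 1 - (j - m2)" "n1 + n2 - 1 - i - n1 = n2 - 1 - i"
      using 2 j by auto
    then show ?thesis using assms i j 2 by auto
  next
    case 3
    have "m1 + m2 - 1 - j - m1 = m2 - 1 - j" "n1 + n2 - 1 - i = n1 - 1 - (i - n2)"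
      using 3 i by auto
    then show ?thesis using assms i j 3 by auto
  next
    case 4
    have "m1 + m2 - 1 - j = m1 - 1 - (j - m2)" "n1 + n2 - 1 - i = n1 - 1 - (i - n2)"
      using 4 i j by auto
    then show ?thesis using assms i j 4 by auto
  qed
qed (use assms in auto)

text \<open>The height bounds make the paddings add up: \<open>dim_row X - dim_row Y\<close> plus
  \<open>dim_row Y - dim_row Z\<close> is \<open>dim_row X - dim_row Z\<close>, despite truncated
  subtraction.\<close>

lemma bottom_join_assoc:
  assumes "dim_row Y \<le> dim_row X" "dim_row Z \<le> dim_row Y"
  shows "(X \<squnion>\<^sub>m Y) \<squnion>\<^sub>m Z = X \<squnion>\<^sub>m (Y \<squnion>\<^sub>m Z)"
  by (rule eq_matI) (use assms in \<open>auto simp: bottom_join_def Let_def diff_diff_left\<close>)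

text \<open>Splits the leftmost matrix off a left-nested join, so that the rest can be recognised as
  a smaller \<open>B_shift\<close>.\<close>

lemma foldl_bottom_join:
  assumes "dim_row Y \<le> dim_row X" "\<And>Z. Z \<in> set Zs \<Longrightarrow> dim_row Z \<le> dim_row Y"
  shows "foldl (\<squnion>\<^sub>m) (X \<squnion>\<^sub>m Y) Zs = X \<squnion>\<^sub>m foldl (\<squnion>\<^sub>m) Y Zs"
  using assms by (induction Zs arbitrary: Y) (simp_all add: bottom_join_assoc)

text \<open>As \<open>C\<close> and \<open>D\<close> have equal height, bottom alignment puts the
  padding ones exactly beside \<open>A\<close>.\<close>

lemma append_rows_bottom_join:
  assumes "A \<in> carrier_mat m1 n1" "C \<in> carrier_mat m2 n1" "D \<in> carrier_mat m2 n2"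
  shows "(A @\<^sub>r C) \<squnion>\<^sub>m D = four_block_mat A (ones_mat m1 n2) C D"
  by (rule eq_matI)
    (use assms in \<open>auto simp: bottom_join_def append_rows_def ones_mat_def Let_def\<close>)

lemma B_shift_carriers:
  "B_shift (Suc (Suc k)) n \<in> carrier_mat ((k + n + 2) choose n) ((k + n + 2) choose (n + 1))"
  "B_shift (Suc k) (Suc n) \<in> carrier_mat ((k + n + 2) choose (n + 1)) ((k + n + 2) choose (n + 2))"
  using B_shift_carrier[of "Suc (Suc k)" n] B_shift_carrier[of "Suc k" "Suc n"]
  by (simp_all del: B_shift.simps binomial_Suc_Suc)

text \<open>The block for index \<open>i\<close> does not depend on \<open>k\<close>, so everything
  after the first block assembles \<open>B_shift (Suc k) (Suc n)\<close>. Reassociating the joins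
  uses that the heights do not increase along the list.\<close>

lemma B_shift_rec:
  "B_shift (Suc (Suc k)) (Suc n) =
    four_block_mat (B_shift (Suc (Suc k)) n)
      (ones_mat ((k + n + 2) choose n) ((k + n + 2) choose (n + 2)))
      (J_mat ((k + n + 2) choose (n + 1))) (B_shift (Suc k) (Suc n))"
proof -
  define block where "block = (\<lambda>i. B_shift i n @\<^sub>r J_mat ((i + n) choose (n + 1)))"
  have row: "dim_row (block i) = (i + Suc n) choose Suc n" if "i \<ge> 1" for i
    using B_shift_carrier[OF that, of n] by (auto simp: block_def append_rows_def)
  have mono: "dim_row (block i) \<le> dim_row (block j)" if "1 \<le> i" "i \<le> j" for i j
    using that by (simp add: row binomial_right_mono del: binomial_Suc_Suc add_Suc_right)
  have eq: "B_shift j (Suc n) = foldl (\<squnion>\<^sub>m) (block j) (map block (rev [1..<j]))" for j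
    by (simp add: block_def)
  have "B_shift (Suc (Suc k)) (Suc n) =
      foldl (\<squnion>\<^sub>m) (block (Suc (Suc k)) \<squnion>\<^sub>m block (Suc k)) (map block (rev [1..<Suc k]))"
    by (simp add: eq del: B_shift.simps)
  also have "\<dots> = block (Suc (Suc k)) \<squnion>\<^sub>m B_shift (Suc k) (Suc n)"
    unfolding eq[of "Suc k"] by (rule foldl_bottom_join) (auto intro!: mono)
  also have "\<dots> = four_block_mat (B_shift (Suc (Suc k)) n)
      (ones_mat ((k + n + 2) choose n) ((k + n + 2) choose (n + 2)))
      (J_mat ((k + n + 2) choose (n + 1))) (B_shift (Suc k) (Suc n))"
    using append_rows_bottom_join[OF B_shift_carriers(1) J_mat_carrier B_shift_carriers(2), of k n]
    by (simp add: block_def del: B_shift.simps binomial_Suc_Suc)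
  finally show ?thesis .
qed

text \<open>Boundary case of the recursion: \<open>J_mat 1\<close> is zero, so each step only adds a
  zero row.\<close>

lemma B_shift_one: "B_shift (Suc 0) n = 0\<^sub>m (Suc n) 1"
proof (induction n)
  case (Suc n)
  have "B_shift (Suc 0) (Suc n) = 0\<^sub>m (Suc n) 1 @\<^sub>r J_mat 1"
    using Suc by simp
  also have "\<dots> = 0\<^sub>m (Suc (Suc n)) 1"
    by (rule eq_matI) (auto simp: append_rows_def J_mat_def ones_mat_def)
  finally show ?case .
qed simp

text \<open>Nested induction: in \<open>B_shift_rec\<close> the upper left block has smaller
  \<open>n\<close> (outer hypothesis, hence \<open>k\<close> arbitrary), the lower right one the
  same \<open>n\<close> and smaller \<open>k\<close> (inner hypothesis).\<close>

lemma flip_transpose_B_shift: "flip_transpose (B_shift (Suc k) n) = B_shift (Suc n) k"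
proof (induction n arbitrary: k)
  case 0
  then show ?case by (simp add: B_shift_one flip_transpose_zero_mat)
next
  case (Suc n)
  note IH = Suc.IH
  show ?case
  proof (induction k)
    case 0
    then show ?case by (simp only: B_shift_one flip_transpose_zero_mat B_shift.simps(1) One_nat_def)
  next
    case (Suc k)
    \<comment> \<open>These turn the block sizes into those of \<open>B_shift_rec\<close> with
      \<open>k\<close> and \<open>n\<close> interchanged.\<close>
    have sym: "(k + n + 2) choose n = (n + k + 2) choose (k + 2)"
      "(k + n + 2) choose (n + 2) = (n + k + 2) choose k"
      "(k + n + 2) choose (n + 1) = (n + k + 2) choose (k + 1)"
      using binomial_symmetric[of n "k + n + 2"] binomial_symmetric[of "n + 2" "k + n + 2"]
        binomial_symmetric[of "n + 1" "k + n + 2"] by (simp_all add: add.commute)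
    show ?case
      unfolding B_shift_rec flip_transpose_four_block_mat[OF B_shift_carriers(1)
          ones_mat_carrier J_mat_carrier B_shift_carriers(2)]
      by (simp only: flip_transpose_ones_mat flip_transpose_J_mat Suc.IH IH sym)
  qed
qed

definition reversal_mat :: "nat \<Rightarrow> int mat" where
  "reversal_mat n = mat n n (\<lambda>(i, j). if i = n - 1 - j then 1 else 0)"

lemma reversal_mat_carrier [simp]: "reversal_mat n \<in> carrier_mat n n"
  by (simp add: reversal_mat_def)

lemma permutation_mat_reversal_mat: "permutation_mat n (reversal_mat n)"
proof -
  \<comment> \<open>Extended by the identity, since \<open>permutes\<close> requires points outside
    the set to be fixed.\<close>
  let ?\<sigma> = "\<lambda>i. if i < n then n - 1 - i else i"
  have "bij_betw ?\<sigma> {..<n} {..<n}"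
    by (rule bij_betw_byWitness[where f' = ?\<sigma>]) auto
  then have "?\<sigma> permutes {..<n}"
    by (rule bij_imp_permutes) simp
  moreover have "reversal_mat n = mat n n (\<lambda>(i, j). if i = ?\<sigma> j then 1 else 0)"
    by (rule eq_matI) (auto simp: reversal_mat_def)
  ultimately show ?thesis
    unfolding permutation_mat_def by blast
qed

lemma reversal_mat_mult:
  assumes "A \<in> carrier_mat n m"
  shows "reversal_mat n * A = mat n m (\<lambda>(i, j). A $$ (n - 1 - i, j))"
proof (rule eq_matI)
  fix i j
  assume "i < dim_row (mat n m (\<lambda>(i, j). A $$ (n - 1 - i, j)))"
    "j < dim_col (mat n m (\<lambda>(i, j). A $$ (n - 1 - i, j)))"
  then have ij: "i < n" "j < m" by auto
  have "(reversal_mat n * A) $$ (i, j) = (\<Sum>l<n. (if i = n - 1 - l then 1 else 0) * A $$ (l, j))"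
    using ij assms by (simp add: reversal_mat_def scalar_prod_def atLeast0LessThan)
  \<comment> \<open>Reversal is an involution below \<open>n\<close>, so the condition can be solved
    for \<open>l\<close>, leaving one term.\<close>
  also have "\<dots> = (\<Sum>l<n. if l = n - 1 - i then A $$ (l, j) else 0)"
    using ij by (intro sum.cong) auto
  also have "\<dots> = A $$ (n - 1 - i, j)"
    using ij by simp
  finally show "(reversal_mat n * A) $$ (i, j) = mat n m (\<lambda>(i, j). A $$ (n - 1 - i, j)) $$ (i, j)"
    using ij by simp
qed (use assms in \<open>auto simp: reversal_mat_def\<close>)

lemma mult_reversal_mat:
  assumes "A \<in> carrier_mat m n"
  shows "A * reversal_mat n = mat m n (\<lambda>(i, j). A $$ (i, n - 1 - j))"
proof (rule eq_matI)
  fix i j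
  assume "i < dim_row (mat m n (\<lambda>(i, j). A $$ (i, n - 1 - j)))"
    "j < dim_col (mat m n (\<lambda>(i, j). A $$ (i, n - 1 - j)))"
  then have ij: "i < m" "j < n" by auto
  have "(A * reversal_mat n) $$ (i, j) = (\<Sum>l<n. A $$ (i, l) * (if l = n - 1 - j then 1 else 0))"
    using ij assms by (simp add: reversal_mat_def scalar_prod_def atLeast0LessThan)
  also have "\<dots> = (\<Sum>l<n. if l = n - 1 - j then A $$ (i, l) else 0)"
    by (intro sum.cong) auto
  also have "\<dots> = A $$ (i, n - 1 - j)"
    using ij by simp
  finally show "(A * reversal_mat n) $$ (i, j) = mat m n (\<lambda>(i, j). A $$ (i, n - 1 - j)) $$ (i, j)"
    using ij by simp
qed (use assms in \<open>auto simp: reversal_mat_def\<close>)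

lemma reversal_mat_mult_self: "reversal_mat n * reversal_mat n = 1\<^sub>m n"
  unfolding reversal_mat_mult[OF reversal_mat_carrier]
  by (rule eq_matI) (auto simp: reversal_mat_def)

text \<open>Conjugation reverses both rows and columns, a half-turn, which is the flip-transpose
  followed by the transpose.\<close>

lemma persymmetric_reversal_conj:
  assumes A: "A \<in> carrier_mat n n" and "persymmetric A"
  shows "reversal_mat n * A * reversal_mat n = transpose_mat A"
proof -
  have eq: "A $$ (n - 1 - i, n - 1 - j) = A $$ (j, i)" if "i < n" "j < n" for i j
    using index_flip_transpose[of j A i] that carrier_matD[OF A]
      \<open>persymmetric A\<close>[unfolded persymmetric_def] by metis
  have "mat n n (\<lambda>(i, j). A $$ (n - 1 - i, j)) \<in> carrier_mat n n"
    by simp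
  then show ?thesis
    unfolding reversal_mat_mult[OF A] by (subst mult_reversal_mat) (use A eq in \<open>auto intro!: eq_matI\<close>)
qed

theorem corollary4p6:
  fixes k :: nat
  assumes "k \<ge> 1"
  shows "persymmetric (B_mat k (int k - 2)) \<and>
    (\<exists>P Q. permutation_mat (dim_row (B_mat k (int k - 2))) P \<and>
       Q \<in> carrier_mat (dim_row (B_mat k (int k - 2))) (dim_row (B_mat k (int k - 2))) \<and>
       inverts_mat P Q \<and> inverts_mat Q P \<and>
       Q * B_mat k (int k - 2) * P = transpose_mat (B_mat k (int k - 2)))"
proof -
  let ?B = "B_mat k (int k - 2)"
  let ?n = "dim_row ?B"
  let ?R = "reversal_mat ?n"
  obtain l where k: "k = Suc l"
    using assms by (cases k) auto
  have "nat (int k - 2 + 1) = l"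
    using k by simp
  \<comment> \<open>The matrix is \<open>B_shift (Suc l) l\<close>, for which the exchange of
    parameters changes nothing.\<close>
  then have "persymmetric ?B"
    by (simp only: persymmetric_def B_mat_def k flip_transpose_B_shift)
  moreover have "?B \<in> carrier_mat ?n ?n"
    using B_mat_square[OF assms] by simp
  moreover have "inverts_mat ?R ?R"
    by (simp add: inverts_mat_def reversal_mat_mult_self carrier_matD[OF reversal_mat_carrier])
  \<comment> \<open>Both witnesses \<open>P\<close> and \<open>Q\<close> are \<open>?R\<close>, its
    own inverse.\<close>
  ultimately show ?thesis
    using permutation_mat_reversal_mat reversal_mat_carrier persymmetric_reversal_conj by blast
qed

end
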